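(* Let $f$ be a bent function on $\mathbb{F}_2^{2m}=\mathbb{F}_2^{m-1}\times\mathbb{F}_2^{m+1}$ defined by $f(x,y)=x\cdot\phi(y)+h(y)$, $x\in\mathbb{F}_2^{m-1}$, $y\in\mathbb{F}_2^{m+1}$, where $\phi\colon\mathbb{F}_2^{m+1}\to\mathbb{F}_2^{m-1}$ and $h\colon\mathbb{F}_2^{m+1}\to\mathbb{F}_2$. Let $\prec$ denote any (strict) total ordering on $\mathbb{F}_2^{m+1}$. Then the dual function $f^*$ of $f$ is given by $$f^*(a,b)=\sum_{\substack{y,y'\in\phi^{-1}(a)\\ y\prec y',\ y\neq y'}}\bigl(h(y)+y\cdot b\bigr)\bigl(h(y')+y'\cdot b\bigr)$$ for all $a\in\mathbb{F}_2^{m-1}$, $b\in\mathbb{F}_2^{m+1}$, where the sum is taken in $\mathbb{F}_2$ and $\phi^{-1}(a)=\{y\in\mathbb{F}_2^{m+1}\mid\phi(y)=a\}$.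
   Context: $m$ is a positive integer. "$\cdot$" is the standard dot product over $\mathbb{F}_2$. For $f\colon\mathbb{F}_2^n\to\mathbb{F}_2$, $W_f(\omega)=\sum_{x\in\mathbb{F}_2^n}(-1)^{f(x)+\omega\cdot x}$. For $n$ even, $f$ is bent if $W_f(\omega)=\pm2^{n/2}$ for all $\omega\in\mathbb{F}_2^n$. The dual $f^*\colon\mathbb{F}_2^n\to\mathbb{F}_2$ of a bent function $f$ is defined by $W_f(\omega)=2^{n/2}(-1)^{f^*(\omega)}$. Here $n=2m$ and $\omega=(a,b)\in\mathbb{F}_2^{m-1}\times\mathbb{F}_2^{m+1}$. *)

theory Defs
  imports "HOL-Library.Z2" "Jordan_Normal_Form.Matrix"
begin

text \<open>
  The space of \<open>n\<close>-bit vectors is \<open>carrier_vec n :: bit vec set\<close>, where \<open>bit\<close> is the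
  two-element field. Carriers are used instead of index types because \<open>n = 0\<close> must be allowed.
  Functions between such spaces are functions on \<open>bit vec\<close> of which only the values on the
  carrier matter.
\<close>

definition sign_bit :: "bit \<Rightarrow> int" where
  "sign_bit c = (- 1) ^ (of_bool (c = 1) :: nat)"

definition walsh :: "nat \<Rightarrow> (bit vec \<Rightarrow> bit) \<Rightarrow> bit vec \<Rightarrow> int" where
  "walsh n f \<omega> = (\<Sum>x \<in> carrier_vec n. sign_bit (f x + \<omega> \<bullet> x))"

definition bent :: "nat \<Rightarrow> (bit vec \<Rightarrow> bit) \<Rightarrow> bool" where
  "bent n f \<longleftrightarrow> even n \<and>
     (\<forall>\<omega> \<in> carrier_vec n. walsh n f \<omega> = 2 ^ (n div 2) \<or> walsh n f \<omega> = - (2 ^ (n div 2)))"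

text \<open>The description below is meaningful for bent \<open>f\<close> and \<open>\<omega> \<in> carrier_vec n\<close>;
  see \<open>walsh_bent_dual\<close>.\<close>

definition bent_dual :: "nat \<Rightarrow> (bit vec \<Rightarrow> bit) \<Rightarrow> bit vec \<Rightarrow> bit" where
  "bent_dual n f \<omega> = (THE c. walsh n f \<omega> = 2 ^ (n div 2) * sign_bit c)"

lemma finite_carrier_bit_vec: "finite (carrier_vec n :: bit vec set)"
proof -
  have "(UNIV :: bit set) \<subseteq> {0, 1}"
    using bit_not_one_iff by blast
  then have fin: "finite (UNIV :: bit set)"
    by (rule finite_subset) simp
  have "carrier_vec n \<subseteq> vec_of_list ` {xs :: bit list. set xs \<subseteq> UNIV \<and> length xs = n}"
  proof
    fix v :: "bit vec"
    assume "v \<in> carrier_vec n"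
    then have "v = vec_of_list (list_of_vec v)" "length (list_of_vec v) = n"
      by (auto simp: vec_list)
    then show "v \<in> vec_of_list ` {xs. set xs \<subseteq> UNIV \<and> length xs = n}"
      by blast
  qed
  then show ?thesis
    using finite_lists_length_eq[OF fin, of n] by (meson finite_imageI finite_subset)
qed

lemma walsh_bent_dual:
  assumes "bent n f" and "\<omega> \<in> carrier_vec n"
  shows "walsh n f \<omega> = 2 ^ (n div 2) * sign_bit (bent_dual n f \<omega>)"
proof -
  have "\<exists>c. walsh n f \<omega> = 2 ^ (n div 2) * sign_bit c"
  proof (cases "walsh n f \<omega> = 2 ^ (n div 2)")
    case True
    then have "walsh n f \<omega> = 2 ^ (n div 2) * sign_bit 0"
      by (simp add: sign_bit_def)
    then show ?thesis by blast
  next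
    case False
    then have "walsh n f \<omega> = 2 ^ (n div 2) * sign_bit 1"
      using assms by (auto simp: bent_def sign_bit_def)
    then show ?thesis by blast
  qed
  moreover have "c = d"
    if "walsh n f \<omega> = 2 ^ (n div 2) * sign_bit c" "walsh n f \<omega> = 2 ^ (n div 2) * sign_bit d"
    for c d
    using that by (cases c; cases d) (auto simp: sign_bit_def)
  ultimately have "\<exists>!c. walsh n f \<omega> = 2 ^ (n div 2) * sign_bit c"
    by blast
  then show ?thesis
    unfolding bent_dual_def by (rule theI')
qed

end

theory Submission
  imports Defs
begin

text \<open>
  The Walsh transform of \<open>f\<close> at \<open>(a, b)\<close> is \<open>2 ^ (m - 1)\<close> times the character sum
  \<open>S b\<close> of \<open>(-1) ^ (h y + y \<bullet> b)\<close> over the fibre \<open>A\<close> of \<open>\<phi>\<close> above \<open>a\<close>, so bentness says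
  \<open>S b = \<plusminus>2\<close> for all \<open>b\<close>. By Parseval the squares of the \<open>S b\<close> average to \<open>card A\<close>, hence
  \<open>card A = 4\<close>. So \<open>h y + y \<bullet> b\<close> takes the value \<open>1\<close> at \<open>k = 1\<close> or \<open>k = 3\<close> points of \<open>A\<close>,
  and the second elementary symmetric function of these values, which is \<open>k choose 2\<close> modulo
  \<open>2\<close>, distinguishes the two signs.
\<close>

lemma sign_bit_simps [simp]: "sign_bit 0 = 1" "sign_bit 1 = - 1"
  by (simp_all add: sign_bit_def)

lemma sign_bit_add: "sign_bit (c + d) = sign_bit c * sign_bit d"
  by (cases c; cases d) simp_all

lemma sign_bit_square: "sign_bit c * sign_bit c = 1"
  by (cases c) simp_all

text \<open>The simp rule \<open>add_bit_eq_xor\<close> rewrites every \<open>+\<close> on \<open>bit\<close> to \<open>XOR\<close>, after which the laws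
  of addition no longer apply; hence it is removed below.\<close>

lemma add_self_bit: "(c :: bit) + c = 0"
  by (cases c) simp_all

lemma add_eq_zero_bit_iff: "(c :: bit) + d = 0 \<longleftrightarrow> c = d"
  by (cases c; cases d) simp_all

lemma card_carrier_bit_vec: "card (carrier_vec n :: bit vec set) = 2 ^ n"
proof -
  have "x \<in> {0, 1}" for x :: bit
    by (cases x) simp_all
  then have UNIV_bit: "(UNIV :: bit set) = {0, 1}"
    by blast
  have "bij_betw list_of_vec (carrier_vec n) {xs :: bit list. set xs \<subseteq> UNIV \<and> length xs = n}"
    by (rule bij_betwI[where g = vec_of_list])
      (auto simp: list_vec vec_list intro: carrier_vecI)
  then have "card (carrier_vec n :: bit vec set) = card {xs :: bit list. set xs \<subseteq> UNIV \<and> length xs = n}"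
    by (rule bij_betw_same_card)
  also have "\<dots> = card (UNIV :: bit set) ^ n"
    by (rule card_lists_length_eq) (simp add: UNIV_bit)
  finally show ?thesis
    by (simp add: UNIV_bit numeral_2_eq_2)
qed

text \<open>In characteristic 2 addition is subtraction. This turns the vanishing condition in the
  orthogonality relation into an equality test, both for pairs of fibre points and for
  \<open>\<phi> y = a\<close>.\<close>

lemma add_bit_vec_eq_zero_iff:
  fixes u v :: "bit vec"
  assumes "u \<in> carrier_vec n" "v \<in> carrier_vec n"
  shows "u + v = 0\<^sub>v n \<longleftrightarrow> u = v"
proof
  assume eq: "u + v = 0\<^sub>v n"
  show "u = v"
  proof (rule eq_vecI)
    fix i assume i: "i < dim_vec v"
    have "(u + v) $ i = 0"
      using eq i assms by simp
    then show "u $ i = v $ i"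
      using i by (simp add: add_eq_zero_bit_iff del: add_bit_eq_xor)
  qed (use assms in simp)
qed (use assms in \<open>auto simp: add_self_bit simp del: add_bit_eq_xor\<close>)

text \<open>Orthogonality of characters: if \<open>u\<close> has a 1 at position \<open>i\<close>,
  flipping coordinate \<open>i\<close> of \<open>x\<close> negates every term, so the sum equals its
  own negative.\<close>

lemma sum_sign_bit_scalar_prod:
  assumes u: "u \<in> carrier_vec n"
  shows "(\<Sum>x \<in> carrier_vec n. sign_bit (u \<bullet> x)) = (if u = 0\<^sub>v n then 2 ^ n else 0)"
proof (cases "u = 0\<^sub>v n")
  case True
  then show ?thesis
    by (simp add: card_carrier_bit_vec)
next
  case False
  then obtain i where i: "i < n" "u $ i = 1"
    using u by (metis bit_not_zero_iff carrier_vecD eq_vecI index_zero_vec)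
  let ?e = "unit_vec n i :: bit vec"
  \<comment> \<open>The flip is an involution, hence its own inverse in the reindexing
    below.\<close>
  have flip_flip: "x + ?e + ?e = x" if "x \<in> carrier_vec n" for x
    using that by (intro eq_vecI) (simp_all add: add.assoc add_self_bit del: add_bit_eq_xor)
  have "(\<Sum>x \<in> carrier_vec n. sign_bit (u \<bullet> x)) = (\<Sum>x \<in> carrier_vec n. sign_bit (u \<bullet> (x + ?e)))"
    by (rule sum.reindex_bij_witness[where i = "\<lambda>x. x + ?e" and j = "\<lambda>x. x + ?e"])
      (simp_all add: flip_flip del: assoc_add_vec)
  also have "\<dots> = (\<Sum>x \<in> carrier_vec n. - sign_bit (u \<bullet> x))"
    using u i
    by (intro sum.cong)
      (simp_all add: scalar_prod_add_distrib[of _ n] sign_bit_add del: add_bit_eq_xor)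
  finally show ?thesis
    using False by (simp add: sum_negf)
qed

text \<open>Expand the square into a sum over pairs \<open>y\<close>, \<open>z\<close> and sum over
  \<open>b\<close> first: by orthogonality only the diagonal survives, and there the signs square to
  1.\<close>

lemma parseval_sign_bit:
  fixes c :: "bit vec \<Rightarrow> bit"
  assumes A: "A \<subseteq> carrier_vec n"
  shows "(\<Sum>b \<in> carrier_vec n. (\<Sum>y \<in> A. sign_bit (c y + y \<bullet> b))\<^sup>2) = 2 ^ n * int (card A)"
proof -
  have fin: "finite A"
    using A finite_carrier_bit_vec finite_subset by blast
  have "(\<Sum>b \<in> carrier_vec n. (\<Sum>y \<in> A. sign_bit (c y + y \<bullet> b))\<^sup>2)
      = (\<Sum>b \<in> carrier_vec n. \<Sum>y \<in> A. \<Sum>z \<in> A. sign_bit (c y) * sign_bit (c z) * sign_bit ((y + z) \<bullet> b))"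
    unfolding power2_eq_square sum_product
    using A
    by (intro sum.cong refl)
      (simp add: add_scalar_prod_distrib[of _ n] subset_iff sign_bit_add mult_ac del: add_bit_eq_xor)
  also have "\<dots> = (\<Sum>y \<in> A. \<Sum>z \<in> A. \<Sum>b \<in> carrier_vec n. sign_bit (c y) * sign_bit (c z) * sign_bit ((y + z) \<bullet> b))"
    by (subst sum.swap, subst (2) sum.swap) (rule refl)
  also have "\<dots> = (\<Sum>y \<in> A. \<Sum>z \<in> A. if y = z then 2 ^ n else 0)"
    using A
    by (intro sum.cong refl)
      (auto simp: subset_iff sum_distrib_left[symmetric] sum_sign_bit_scalar_prod
        add_bit_vec_eq_zero_iff[of _ n] sign_bit_square)
  also have "\<dots> = 2 ^ n * int (card A)"
    using fin by simp
  finally show ?thesis .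
qed

lemma vec_first_append: "v \<in> carrier_vec n \<Longrightarrow> vec_first (v @\<^sub>v w) n = v"
  by (intro eq_vecI) (auto simp: vec_first_def)

lemma vec_last_append: "w \<in> carrier_vec n \<Longrightarrow> vec_last (v @\<^sub>v w) n = w"
  by (intro eq_vecI) (auto simp: vec_last_def)

text \<open>Cutting a vector after position \<open>p\<close> inverts concatenation, so a Walsh sum
  can be carried out in each half separately.\<close>

lemma sum_carrier_vec_append:
  "(\<Sum>z \<in> carrier_vec (p + q). g z) = (\<Sum>x \<in> carrier_vec p. \<Sum>y \<in> carrier_vec q. g (x @\<^sub>v y))"
proof -
  have "(\<Sum>z \<in> carrier_vec (p + q). g z)
      = (\<Sum>(x, y) \<in> carrier_vec p \<times> carrier_vec q. g (x @\<^sub>v y))"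
    by (rule sum.reindex_bij_witness[where i = "\<lambda>(x, y). x @\<^sub>v y"
          and j = "\<lambda>z. (vec_first z p, vec_last z q)"])
      (auto simp: vec_first_append vec_last_append)
  then show ?thesis
    by (simp add: sum.cartesian_product)
qed

text \<open>For fixed \<open>y\<close> the exponent is affine in \<open>x\<close> with linear part
  \<open>\<phi> y + a\<close>, so summing over \<open>x\<close> first leaves only the fibre of
  \<open>\<phi>\<close> above \<open>a\<close>.\<close>

lemma walsh_maiorana_mcfarland:
  fixes f h :: "bit vec \<Rightarrow> bit" and \<phi> :: "bit vec \<Rightarrow> bit vec"
  assumes \<phi>: "\<phi> \<in> carrier_vec q \<rightarrow> carrier_vec p"
    and f: "\<And>x y. x \<in> carrier_vec p \<Longrightarrow> y \<in> carrier_vec q \<Longrightarrow> f (x @\<^sub>v y) = x \<bullet> \<phi> y + h y"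
    and a: "a \<in> carrier_vec p" and b: "b \<in> carrier_vec q"
  shows "walsh (p + q) f (a @\<^sub>v b)
    = 2 ^ p * (\<Sum>y \<in> {y \<in> carrier_vec q. \<phi> y = a}. sign_bit (h y + y \<bullet> b))"
proof -
  have "walsh (p + q) f (a @\<^sub>v b)
      = (\<Sum>x \<in> carrier_vec p. \<Sum>y \<in> carrier_vec q. sign_bit (h y + y \<bullet> b) * sign_bit ((\<phi> y + a) \<bullet> x))"
    unfolding walsh_def sum_carrier_vec_append
  proof (intro sum.cong refl)
    fix x y :: "bit vec"
    assume x: "x \<in> carrier_vec p" and y: "y \<in> carrier_vec q"
    have \<phi>y: "\<phi> y \<in> carrier_vec p"
      using \<phi> y by auto
    have append: "(a @\<^sub>v b) \<bullet> (x @\<^sub>v y) = a \<bullet> x + y \<bullet> b"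
      using scalar_prod_append[OF a b x y] comm_scalar_prod[OF b y] by (simp only:)
    have add: "(\<phi> y + a) \<bullet> x = x \<bullet> \<phi> y + a \<bullet> x"
      using add_scalar_prod_distrib[OF \<phi>y a x] comm_scalar_prod[OF \<phi>y x] by (simp only:)
    show "sign_bit (f (x @\<^sub>v y) + (a @\<^sub>v b) \<bullet> (x @\<^sub>v y))
        = sign_bit (h y + y \<bullet> b) * sign_bit ((\<phi> y + a) \<bullet> x)"
      unfolding f[OF x y] append add by (simp only: sign_bit_add mult_ac)
  qed
  also have "\<dots> = (\<Sum>y \<in> carrier_vec q. sign_bit (h y + y \<bullet> b) * (\<Sum>x \<in> carrier_vec p. sign_bit ((\<phi> y + a) \<bullet> x)))"
    by (subst sum.swap) (simp only: sum_distrib_left)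
  also have "\<dots> = (\<Sum>y \<in> carrier_vec q. if \<phi> y = a then 2 ^ p * sign_bit (h y + y \<bullet> b) else 0)"
  proof (intro sum.cong refl)
    fix y :: "bit vec" assume "y \<in> carrier_vec q"
    then have "\<phi> y \<in> carrier_vec p"
      using \<phi> by auto
    then show "sign_bit (h y + y \<bullet> b) * (\<Sum>x \<in> carrier_vec p. sign_bit ((\<phi> y + a) \<bullet> x))
        = (if \<phi> y = a then 2 ^ p * sign_bit (h y + y \<bullet> b) else 0)"
      using a by (simp add: sum_sign_bit_scalar_prod add_bit_vec_eq_zero_iff[of _ p] del: add_bit_eq_xor)
  qed
  also have "\<dots> = 2 ^ p * (\<Sum>y \<in> {y \<in> carrier_vec q. \<phi> y = a}. sign_bit (h y + y \<bullet> b))"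
    by (simp add: sum.inter_filter[OF finite_carrier_bit_vec, symmetric] sum_distrib_left)
  finally show ?thesis .
qed

text \<open>Each two-element subset of \<open>T\<close> is ordered by \<open>R\<close> in exactly
  one way: totality gives at least one, asymmetry at most one.\<close>

lemma card_ordered_pairs:
  assumes fin: "finite T"
    and irr: "irreflp_on T R" and trans: "transp_on T R" and total: "totalp_on T R"
  shows "card {(x, y). x \<in> T \<and> y \<in> T \<and> R x y} = card T choose 2"
proof -
  have asym: "\<not> R y x" if "R x y" "x \<in> T" "y \<in> T" for x y
    using irr trans that by (meson irreflp_onD transp_onD)
  have "bij_betw (\<lambda>(x, y). {x, y}) {(x, y). x \<in> T \<and> y \<in> T \<and> R x y} {B. B \<subseteq> T \<and> card B = 2}"
    unfolding bij_betw_def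
  proof (intro conjI equalityI subsetI)
    show "inj_on (\<lambda>(x, y). {x, y}) {(x, y). x \<in> T \<and> y \<in> T \<and> R x y}"
      using asym by (auto simp: inj_on_def doubleton_eq_iff)
  next
    fix B assume "B \<in> (\<lambda>(x, y). {x, y}) ` {(x, y). x \<in> T \<and> y \<in> T \<and> R x y}"
    then obtain x y where xy: "B = {x, y}" "x \<in> T" "y \<in> T" "R x y"
      by auto
    then have "x \<noteq> y"
      using asym by blast
    then show "B \<in> {B. B \<subseteq> T \<and> card B = 2}"
      using xy by simp
  next
    fix B assume "B \<in> {B. B \<subseteq> T \<and> card B = 2}"
    then obtain x y where xy: "B = {x, y}" "x \<in> T" "y \<in> T" "x \<noteq> y"
      by (auto simp: card_2_iff)
    then consider "R x y" | "R y x"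
      using total by (auto dest: totalp_onD)
    then show "B \<in> (\<lambda>(x, y). {x, y}) ` {(x, y). x \<in> T \<and> y \<in> T \<and> R x y}"
      using xy by cases (auto intro: rev_image_eqI)
  qed
  then show ?thesis
    using n_subsets[OF fin, of 2] by (simp add: bij_betw_same_card)
qed

text \<open>Each sign is 1 minus twice the indicator of \<open>c y = 1\<close>.\<close>

lemma sum_sign_bit_eq_card:
  assumes "finite A"
  shows "(\<Sum>y \<in> A. sign_bit (c y)) = int (card A) - 2 * int (card {y \<in> A. c y = 1})"
proof -
  have "(\<Sum>y \<in> A. sign_bit (c y)) = (\<Sum>y \<in> A. 1 - 2 * of_bool (c y = 1))"
    by (rule sum.cong) (auto simp: sign_bit_def)
  also have "\<dots> = int (card A) - 2 * int (card {y \<in> A. c y = 1})"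
    using assms by (simp add: sum_subtractf sum_distrib_left[symmetric] Int_def conj_commute)
  finally show ?thesis .
qed

text \<open>A product of two bits is 1 only if both are, so the sum counts, modulo 2, the ordered
  pairs inside the support of \<open>c\<close>.\<close>

lemma sum_pairs_bit_eq_choose:
  fixes c :: "'a \<Rightarrow> bit"
  assumes fin: "finite A"
    and order: "irreflp_on A R" "transp_on A R" "totalp_on A R"
  shows "(\<Sum>(y, y') \<in> {(y, y'). y \<in> A \<and> y' \<in> A \<and> R y y' \<and> y \<noteq> y'}. c y * c y')
    = of_nat (card {y \<in> A. c y = 1} choose 2)"
proof -
  let ?T = "{y \<in> A. c y = 1}"
  let ?P = "{(y, y'). y \<in> A \<and> y' \<in> A \<and> R y y' \<and> y \<noteq> y'}"
  have finP: "finite ?P"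
    by (rule finite_subset[of _ "A \<times> A"]) (use fin in auto)
  \<comment> \<open>Irreflexivity makes the condition \<open>y \<noteq> y'\<close> redundant on the
    right.\<close>
  have "(\<Sum>(y, y') \<in> ?P. c y * c y') = (\<Sum>(y, y') \<in> {(y, y'). y \<in> ?T \<and> y' \<in> ?T \<and> R y y'}. 1)"
    using finP order(1)
    by (intro sum.mono_neutral_cong_right) (auto dest: irreflp_onD)
  also have "\<dots> = of_nat (card {(y, y'). y \<in> ?T \<and> y' \<in> ?T \<and> R y y'})"
    by simp
  also have "card {(y, y'). y \<in> ?T \<and> y' \<in> ?T \<and> R y y'} = card ?T choose 2"
    using fin order
    by (intro card_ordered_pairs)
      (auto intro: irreflp_on_subset transp_on_subset totalp_on_subset)
  finally show ?thesis .
qed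

theorem theorem3p4:
  fixes m :: nat
    and f h :: "bit vec \<Rightarrow> bit"
    and \<phi> :: "bit vec \<Rightarrow> bit vec"
    and prec :: "bit vec \<Rightarrow> bit vec \<Rightarrow> bool"  (infix "\<prec>" 50)
  assumes "m > 0"
    and "\<phi> \<in> carrier_vec (m + 1) \<rightarrow> carrier_vec (m - 1)"
    and "\<And>x y. x \<in> carrier_vec (m - 1) \<Longrightarrow> y \<in> carrier_vec (m + 1) \<Longrightarrow>
           f (x @\<^sub>v y) = x \<bullet> \<phi> y + h y"
    and "bent (2 * m) f"
    and "irreflp_on (carrier_vec (m + 1)) (\<prec>)"
    and "transp_on (carrier_vec (m + 1)) (\<prec>)"
    and "totalp_on (carrier_vec (m + 1)) (\<prec>)"
  shows "\<forall>a \<in> carrier_vec (m - 1). \<forall>b \<in> carrier_vec (m + 1).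
    bent_dual (2 * m) f (a @\<^sub>v b) =
      (\<Sum>(y, y') \<in> {(y, y'). y \<in> {y \<in> carrier_vec (m + 1). \<phi> y = a} \<and>
                           y' \<in> {y \<in> carrier_vec (m + 1). \<phi> y = a} \<and> y \<prec> y' \<and> y \<noteq> y'}.
         (h y + y \<bullet> b) * (h y' + y' \<bullet> b))"
proof (intro ballI)
  fix a b :: "bit vec"
  assume a: "a \<in> carrier_vec (m - 1)" and b: "b \<in> carrier_vec (m + 1)"
  define A where "A = {y \<in> carrier_vec (m + 1). \<phi> y = a}"
  define S where "S b = (\<Sum>y \<in> A. sign_bit (h y + y \<bullet> b))" for b
  have A: "A \<subseteq> carrier_vec (m + 1)"
    by (auto simp: A_def)
  have fin: "finite A"
    using A finite_carrier_bit_vec finite_subset by blast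
  have dim: "(m - 1) + (m + 1) = 2 * m" and pow: "(2 :: int) ^ m = 2 ^ (m - 1) * 2"
    using \<open>m > 0\<close> by (simp_all flip: power_Suc2)
  \<comment> \<open>Needed for every \<open>b\<close>, not only the fixed one, because Parseval sums
    over all of them. The 2 is the quotient of \<open>2 ^ m\<close> by
    \<open>2 ^ (m - 1)\<close>.\<close>
  have S: "S b = 2 * sign_bit (bent_dual (2 * m) f (a @\<^sub>v b))" if b: "b \<in> carrier_vec (m + 1)" for b
  proof -
    have "2 ^ (m - 1) * S b = walsh (2 * m) f (a @\<^sub>v b)"
      using walsh_maiorana_mcfarland[OF assms(2,3) a b] unfolding dim S_def A_def by simp
    also have "\<dots> = 2 ^ m * sign_bit (bent_dual (2 * m) f (a @\<^sub>v b))"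
      using walsh_bent_dual[OF assms(4), of "a @\<^sub>v b"] append_carrier_vec[OF a b] unfolding dim by simp
    finally show ?thesis
      by (simp add: pow)
  qed
  \<comment> \<open>Evaluate the sum of squares twice, by Parseval and by bentness, and
    compare.\<close>
  have "2 ^ (m + 1) * int (card A) = (\<Sum>b \<in> carrier_vec (m + 1). (S b)\<^sup>2)"
    unfolding S_def by (rule parseval_sign_bit[OF A, symmetric])
  also have "\<dots> = (\<Sum>b \<in> (carrier_vec (m + 1) :: bit vec set). 4)"
    by (rule sum.cong) (simp_all add: S power2_eq_square sign_bit_square)
  also have "\<dots> = 2 ^ (m + 1) * 4"
    by (simp add: card_carrier_bit_vec)
  finally have card_A: "card A = 4"
    by simp
  define k where "k = card {y \<in> A. h y + y \<bullet> b = 1}"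
  have k: "2 * sign_bit (bent_dual (2 * m) f (a @\<^sub>v b)) = 4 - 2 * int k"
    using sum_sign_bit_eq_card[OF fin, of "\<lambda>y. h y + y \<bullet> b"] S[OF b]
    unfolding S_def k_def card_A by simp
  \<comment> \<open>The sign 1 forces \<open>k = 1\<close>, with binomial coefficient 0; the sign -1
    forces \<open>k = 3\<close>, with coefficient 3, which is 1 as a bit.\<close>
  have "bent_dual (2 * m) f (a @\<^sub>v b) = of_nat (k choose 2)"
  proof (cases "bent_dual (2 * m) f (a @\<^sub>v b) = 0")
    case True
    with k have "k = 1" by simp
    with True show ?thesis by (simp add: choose_two)
  next
    case False
    then have 1: "bent_dual (2 * m) f (a @\<^sub>v b) = 1" by simp
    with k have "k = 3" by simp
    with 1 show ?thesis by (simp add: choose_two)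
  qed
  also have "\<dots> = (\<Sum>(y, y') \<in> {(y, y'). y \<in> A \<and> y' \<in> A \<and> y \<prec> y' \<and> y \<noteq> y'}.
      (h y + y \<bullet> b) * (h y' + y' \<bullet> b))"
    unfolding k_def using fin assms(5-7) A
    by (intro sum_pairs_bit_eq_choose[symmetric])
      (blast intro: irreflp_on_subset transp_on_subset totalp_on_subset)+
  finally show "bent_dual (2 * m) f (a @\<^sub>v b) =
      (\<Sum>(y, y') \<in> {(y, y'). y \<in> {y \<in> carrier_vec (m + 1). \<phi> y = a} \<and>
                           y' \<in> {y \<in> carrier_vec (m + 1). \<phi> y = a} \<and> y \<prec> y' \<and> y \<noteq> y'}.
         (h y + y \<bullet> b) * (h y' + y' \<bullet> b))"
    unfolding A_def .
qed

end
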